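(* Let $a\in\mathbb C$. If $X$ is a $G_\delta$-subset of $\mathbb C$ that is contained in $I(f_a)$, then the pre-images $f_a^{-n}[X]$, $n=0,1,2,\ldots$, do not cover $I(f_a)$. Thus there exists $z\in I(f_a)$ such that $f_a^n(z)\notin X$ for all $n=0,1,2,3,\ldots$.
   Context: For $a\in\mathbb C$, $f_a:\mathbb C\to\mathbb C$ is defined by $f_a(z)=e^z+a$; $f_a^n$ denotes the $n$-fold composition of $f_a$ (with $f_a^0$ the identity), and $f_a^{-n}[X]=\{z\in\mathbb C: f_a^n(z)\in X\}$. The escaping set is $I(f_a)=\{z\in\mathbb C: |f_a^n(z)|\to\infty \text{ as } n\to\infty\}$. A $G_\delta$-subset of a space is a countable intersection of open subsets. *)

theory Defs
  imports "HOL-Analysis.Analysis"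
begin

definition exp_map :: "complex \<Rightarrow> complex \<Rightarrow> complex" where
  "exp_map a z = exp z + a"

definition escaping_set :: "(complex \<Rightarrow> complex) \<Rightarrow> complex set" where
  "escaping_set f = {z. filterlim (\<lambda>n. norm ((f ^^ n) z)) at_top sequentially}"

end

theory Submission
  imports Defs "HOL-Real_Asymp.Real_Asymp"
begin

text \<open>
  Let \<open>L\<^sub>k(w) = Ln (w - a) + 2\<pi>i(k + q)\<close> be inverse branches of \<open>z \<mapsto> exp z + a\<close>, with \<open>q\<close>
  so large that all of them are contractions by \<open>1/2\<close> of one upper half-plane into itself. Every
  sequence \<open>s\<close> of naturals of at most linear growth is the itinerary of a point
  \<open>\<Phi>(s) = lim L\<^sub>s\<^sub>0 (L\<^sub>s\<^sub>1 (\<dots>))\<close>, which depends continuously on \<open>s\<close>. This point escapes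
  if \<open>s\<close> tends to infinity, but not if \<open>s\<close> has a fixed digit on arbitrarily late and long blocks.

  Given a \<open>G\<^sub>\<delta>\<close> set \<open>X\<close> of escaping points and a finite prefix, consider the sequences extending
  it by digits at least \<open>n\<close>. If \<open>X\<close> met the image of each of their cylinders, a Baire category
  argument would give a point of \<open>X\<close> whose itinerary has infinitely many long blocks of the
  digit \<open>n\<close>. So some longer prefix avoids \<open>X\<close>. Doing this for the \<open>n\<close>-th preimage of \<open>X\<close>
  for all \<open>n\<close> in turn yields an itinerary tending to infinity whose point avoids all preimages.
\<close>

text \<open>All error estimates take this form: linear growth of the digits against contraction by
  \<open>2 ^ n\<close>.\<close>

lemma linear_over_power2_tendsto_0:
  fixes B c :: real
  shows "(\<lambda>n. B * (c + real n + 2) / 2 ^ n) \<longlonglongrightarrow> 0"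
proof -
  have "(\<lambda>n. (c + real n + 2) / 2 ^ n) \<longlonglongrightarrow> 0"
    by real_asymp
  then show ?thesis
    using tendsto_mult_right_zero by fastforce
qed

section \<open>Inverse branches and their compositions on a half-plane\<close>

context
  fixes a :: complex
begin

text \<open>The margin 2 keeps \<open>w - a\<close> off the cut of \<open>Ln\<close> and at modulus
  at least 2, so the derivative \<open>1 / (w - a)\<close> of each branch has modulus at most
  1/2.\<close>

definition hplane :: "complex set" where
  "hplane = {w. Im w \<ge> cmod a + 2}"

definition base :: complex where
  "base = Complex 0 (cmod a + 2)"

definition branch :: "nat \<Rightarrow> complex \<Rightarrow> complex" where
  "branch k w = Ln (w - a) + of_real (2 * pi * real (k + nat \<lceil>cmod a + 2\<rceil>)) * \<i>"

primrec pullback :: "nat \<Rightarrow> (nat \<Rightarrow> nat) \<Rightarrow> complex \<Rightarrow> complex" where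
  "pullback 0 s w = w"
| "pullback (Suc n) s w = branch (s 0) (pullback n (\<lambda>i. s (Suc i)) w)"

text \<open>Convergence of this limit is shown for \<open>s i \<le> i + c\<close>. The constant
  \<open>c\<close> is there for shifts: dropping \<open>n\<close> digits turns \<open>c\<close> into
  \<open>c + n\<close>.\<close>

definition coded :: "(nat \<Rightarrow> nat) \<Rightarrow> complex" where
  "coded s = lim (\<lambda>n. pullback n s base)"

definition spread :: real where
  "spread = 2 * dist (branch 0 base) base + 4 * pi"

lemma base_in_hplane: "base \<in> hplane"
  by (simp add: base_def hplane_def)

lemma Im_diff_ge: "w \<in> hplane \<Longrightarrow> Im (w - a) \<ge> 2"
  using abs_Im_le_cmod[of a] by (simp add: hplane_def)

text \<open>\<open>Ln\<close> contributes a nonnegative imaginary part, and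
  \<open>2 * pi * x \<ge> x\<close> does the rest. The offset in \<open>branch\<close> returns the
  point to \<open>hplane\<close>; the digit \<open>k\<close> raises it further, which later forces
  escape.\<close>

lemma Im_branch_ge:
  assumes "w \<in> hplane"
  shows "Im (branch k w) \<ge> real k + cmod a + 2"
proof -
  have "w - a \<noteq> 0" "Im (w - a) \<ge> 0"
    using Im_diff_ge[OF assms] by auto
  then have "Im (Ln (w - a)) \<ge> 0"
    using Im_Ln_pos_le by blast
  moreover have "real (k + nat \<lceil>cmod a + 2\<rceil>) \<ge> real k + cmod a + 2"
    by (simp add: add.assoc) linarith
  moreover have "2 * pi * x \<ge> x" if "x \<ge> 0" for x :: real
    using that pi_gt3 mult_right_mono[of 1 "2 * pi" x] by simp
  ultimately have "real k + cmod a + 2 \<le> 2 * pi * real (k + nat \<lceil>cmod a + 2\<rceil>)"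
    by (meson of_nat_0_le_iff order_trans)
  with \<open>Im (Ln (w - a)) \<ge> 0\<close> show ?thesis
    by (simp add: branch_def)
qed

lemma branch_in_hplane: "w \<in> hplane \<Longrightarrow> branch k w \<in> hplane"
  using Im_branch_ge[of w k] by (simp add: hplane_def)

lemma exp_map_branch:
  assumes "w \<in> hplane"
  shows "exp_map a (branch k w) = w"
proof -
  have "w - a \<noteq> 0"
    using Im_diff_ge[OF assms] by auto
  moreover have "exp (of_real (2 * pi * real m) * \<i>) = 1" for m
    using exp_integer_2pi[of "of_nat m"] by (simp add: mult_ac)
  ultimately show ?thesis
    by (simp only: exp_map_def branch_def exp_add exp_Ln) simp
qed

lemma dist_branch_le:
  assumes "w \<in> hplane" "w' \<in> hplane"
  shows "dist (branch k w) (branch k w') \<le> dist w w' / 2"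
proof -
  have cvx: "convex hplane"
    using convex_halfspace_Im_ge by (simp add: hplane_def)
  have "cmod (branch k w - branch k w') \<le> (1/2) * cmod (w - w')"
  proof (rule field_differentiable_bound[OF cvx, where f' = "\<lambda>z. 1 / (z - a)"])
    fix z assume z: "z \<in> hplane"
    from Im_diff_ge[OF z] have "z - a \<notin> \<real>\<^sub>\<le>\<^sub>0"
      by (auto simp: complex_nonpos_Reals_iff)
    then show "(branch k has_field_derivative 1 / (z - a)) (at z within hplane)"
      unfolding branch_def[abs_def]
      by (auto intro!: derivative_eq_intros simp: inverse_eq_divide)
    have "cmod (z - a) \<ge> 2"
      using Im_diff_ge[OF z] abs_Im_le_cmod[of "z - a"] by linarith
    then show "cmod (1 / (z - a)) \<le> 1/2"
      by (simp add: norm_divide divide_simps)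
  qed (use assms in auto)
  then show ?thesis
    by (simp add: dist_norm)
qed

lemma pullback_in_hplane: "w \<in> hplane \<Longrightarrow> pullback n s w \<in> hplane"
  by (induction n arbitrary: s) (simp_all add: branch_in_hplane)

lemma pullback_add: "pullback (m + n) s w = pullback m s (pullback n (\<lambda>i. s (m + i)) w)"
  by (induction m arbitrary: s) simp_all

lemma pullback_cong: "(\<And>i. i < n \<Longrightarrow> s i = s' i) \<Longrightarrow> pullback n s w = pullback n s' w"
proof (induction n arbitrary: s s')
  case (Suc n)
  have "pullback n (\<lambda>i. s (Suc i)) w = pullback n (\<lambda>i. s' (Suc i)) w"
    by (rule Suc.IH) (simp add: Suc.prems)
  then show ?case
    by (simp add: Suc.prems)
qed simp

lemma dist_pullback_le:
  assumes "w \<in> hplane" "w' \<in> hplane"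
  shows "dist (pullback n s w) (pullback n s w') \<le> dist w w' / 2 ^ n"
proof (induction n arbitrary: s)
  case (Suc n)
  have "dist (pullback (Suc n) s w) (pullback (Suc n) s w')
      \<le> dist (pullback n (\<lambda>i. s (Suc i)) w) (pullback n (\<lambda>i. s (Suc i)) w') / 2"
    by (simp only: pullback.simps) (intro dist_branch_le pullback_in_hplane assms)
  also have "\<dots> \<le> (dist w w' / 2 ^ n) / 2"
    by (intro divide_right_mono Suc.IH) simp
  finally show ?case
    by (simp add: mult.commute)
qed simp

section \<open>Convergence of pullbacks to coded points\<close>

lemma spread_nonneg: "spread \<ge> 0"
  by (simp add: spread_def)

lemma dist_branch_base_le: "dist (branch k base) base \<le> spread / 2 * (real k + 1)"
proof -
  have "branch k base - branch 0 base = of_real (2 * pi * real k) * \<i>"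
    by (simp add: branch_def algebra_simps)
  then have "dist (branch k base) (branch 0 base) = 2 * pi * real k"
    by (simp only: dist_norm norm_mult norm_of_real) simp
  then have "dist (branch k base) base \<le> 2 * pi * real k + dist (branch 0 base) base"
    using dist_triangle[of "branch k base" base "branch 0 base"] by simp
  also have "\<dots> \<le> (dist (branch 0 base) base + 2 * pi) * (real k + 1)"
    by (simp add: algebra_simps)
  finally show ?thesis
    by (simp add: spread_def add_divide_distrib)
qed

text \<open>Removing the first digit raises \<open>c\<close> by one, but the branch halves the
  resulting bound. The value of \<open>spread\<close> makes the induction close exactly: half of
  \<open>c + 3\<close> plus half of \<open>c + 1\<close> is \<open>c + 2\<close>.\<close>

lemma dist_pullback_base_le:
  assumes "\<And>i. s i \<le> i + c"
  shows "dist (pullback n s base) base \<le> spread * (real c + 2)"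
  using assms
proof (induction n arbitrary: s c)
  case 0
  then show ?case by (simp add: spread_nonneg)
next
  case (Suc n)
  have "s (Suc i) \<le> i + Suc c" for i
    using Suc.prems[of "Suc i"] by simp
  then have IH: "dist (pullback n (\<lambda>i. s (Suc i)) base) base \<le> spread * (real (Suc c) + 2)"
    by (rule Suc.IH)
  have "dist (pullback (Suc n) s base) base
      \<le> dist (pullback (Suc n) s base) (branch (s 0) base) + dist (branch (s 0) base) base"
    by (rule dist_triangle)
  also have "\<dots> \<le> dist (pullback n (\<lambda>i. s (Suc i)) base) base / 2 + spread / 2 * (real (s 0) + 1)"
    by (simp only: pullback.simps)
       (intro add_mono dist_branch_base_le dist_branch_le pullback_in_hplane base_in_hplane)
  also have "\<dots> \<le> spread * (real (Suc c) + 2) / 2 + spread / 2 * (real c + 1)"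
    using IH Suc.prems[of 0] spread_nonneg by (intro add_mono mult_left_mono) auto
  also have "\<dots> = spread * (real c + 2)"
    by (simp add: field_simps)
  finally show ?case .
qed

lemma LIMSEQ_pullback:
  assumes "\<And>i. s i \<le> i + c"
  shows "(\<lambda>n. pullback n s base) \<longlonglongrightarrow> coded s"
proof -
  \<comment> \<open>Both points are images under the same \<open>n\<close> contractions, one of
    \<open>base\<close> and one of a pullback along the shifted sequence, whose bound is
    \<open>c + n\<close>.\<close>
  have *: "dist (pullback n s base) (pullback m s base) \<le> spread * (real c + real n + 2) / 2 ^ n"
    if nm: "n \<le> m" for m n
  proof -
    obtain p where m: "m = n + p"
      using le_Suc_ex[OF nm] by blast
    have "s (n + i) \<le> i + (c + n)" for i
      using assms[of "n + i"] by simp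
    then have "dist base (pullback p (\<lambda>i. s (n + i)) base) \<le> spread * (real (c + n) + 2)"
      by (subst dist_commute) (rule dist_pullback_base_le)
    then have "dist base (pullback p (\<lambda>i. s (n + i)) base) / 2 ^ n
        \<le> spread * (real c + real n + 2) / 2 ^ n"
      by (simp add: divide_right_mono)
    then show ?thesis
      unfolding m pullback_add
      by (rule order_trans[OF dist_pullback_le[OF base_in_hplane pullback_in_hplane[OF base_in_hplane]]])
  qed
  have "Cauchy (\<lambda>n. pullback n s base)"
    unfolding Cauchy_altdef
  proof (intro allI impI)
    fix e :: real assume "e > 0"
    then have "\<forall>\<^sub>F n in sequentially. spread * (real c + real n + 2) / 2 ^ n < e"
      by (rule order_tendstoD[OF linear_over_power2_tendsto_0])
    then obtain M where "\<And>n. n \<ge> M \<Longrightarrow> spread * (real c + real n + 2) / 2 ^ n < e"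
      by (auto simp: eventually_sequentially)
    then show "\<exists>M. \<forall>m\<ge>M. \<forall>n>m. dist (pullback m s base) (pullback n s base) < e"
      by (intro exI[of _ M] allI impI le_less_trans[OF *]) auto
  qed
  then show ?thesis
    by (simp add: coded_def Cauchy_convergent_iff convergent_LIMSEQ_iff)
qed

lemma coded_in_hplane:
  assumes "\<And>i. s i \<le> i + c"
  shows "coded s \<in> hplane"
proof (rule Lim_in_closed_set[OF _ _ _ LIMSEQ_pullback[OF assms]])
  show "closed hplane"
    using closed_halfspace_Im_ge by (simp add: hplane_def)
qed (simp_all add: pullback_in_hplane base_in_hplane)

lemma dist_coded_base_le:
  assumes "\<And>i. s i \<le> i + c"
  shows "dist (coded s) base \<le> spread * (real c + 2)"
  by (rule tendsto_upperbound[OF tendsto_dist[OF LIMSEQ_pullback[OF assms] tendsto_const]])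
     (simp_all add: dist_pullback_base_le[OF assms])

text \<open>The first \<open>n\<close> branches compose to a continuous map on
  \<open>hplane\<close>, so both sides are limits of the same pullbacks.\<close>

lemma coded_eq_pullback:
  assumes "\<And>i. s i \<le> i + c"
  shows "coded s = pullback n s (coded (\<lambda>i. s (n + i)))"
proof (rule LIMSEQ_unique)
  have le: "s (n + i) \<le> i + (c + n)" for i
    using assms[of "n + i"] by simp
  show "(\<lambda>m. pullback (m + n) s base) \<longlonglongrightarrow> coded s"
    using LIMSEQ_pullback[OF assms] by (rule LIMSEQ_ignore_initial_segment)
  let ?v = "coded (\<lambda>i. s (n + i))"
  have "dist (pullback n s (pullback m (\<lambda>i. s (n + i)) base)) (pullback n s ?v)
      \<le> dist (pullback m (\<lambda>i. s (n + i)) base) ?v" for m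
  proof -
    have "dist (pullback n s (pullback m (\<lambda>i. s (n + i)) base)) (pullback n s ?v)
        \<le> dist (pullback m (\<lambda>i. s (n + i)) base) ?v / 2 ^ n"
      by (intro dist_pullback_le pullback_in_hplane base_in_hplane coded_in_hplane[OF le])
    also have "\<dots> \<le> dist (pullback m (\<lambda>i. s (n + i)) base) ?v / 1"
      by (intro divide_left_mono) auto
    finally show ?thesis
      by simp
  qed
  then have "(\<lambda>m. pullback n s (pullback m (\<lambda>i. s (n + i)) base)) \<longlonglongrightarrow> pullback n s ?v"
    by (intro metric_tendsto_imp_tendsto[OF LIMSEQ_pullback[OF le]] always_eventually allI)
  then show "(\<lambda>m. pullback (m + n) s base) \<longlonglongrightarrow> pullback n s ?v"
    by (simp only: add.commute[of _ n] pullback_add)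
qed

section \<open>The shift on itineraries, and escape read off from digits\<close>

lemma exp_map_funpow_pullback: "w \<in> hplane \<Longrightarrow> (exp_map a ^^ n) (pullback n s w) = w"
proof (induction n arbitrary: s)
  case (Suc n)
  then show ?case
    by (simp add: funpow_Suc_right exp_map_branch pullback_in_hplane del: funpow.simps)
qed simp

lemma exp_map_funpow_coded:
  assumes "\<And>i. s i \<le> i + c"
  shows "(exp_map a ^^ n) (coded s) = coded (\<lambda>i. s (n + i))"
proof -
  have "s (n + i) \<le> i + (c + n)" for i
    using assms[of "n + i"] by simp
  then show ?thesis
    using exp_map_funpow_pullback[OF coded_in_hplane] coded_eq_pullback[OF assms] by metis
qed

lemma Im_coded_ge:
  assumes "\<And>i. s i \<le> i + c"
  shows "Im (coded s) \<ge> real (s 0)"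
proof -
  have le: "s (1 + i) \<le> i + (c + 1)" for i
    using assms[of "1 + i"] by simp
  have eq: "coded s = branch (s 0) (coded (\<lambda>i. s (1 + i)))"
    using coded_eq_pullback[OF assms, where n = 1] by simp
  have "real (s 0) + cmod a + 2 \<le> Im (coded s)"
    by (subst eq) (rule Im_branch_ge[OF coded_in_hplane[OF le]])
  then show ?thesis
    using norm_ge_zero[of a] by linarith
qed

text \<open>Common digits give common contractions, applied to two points near \<open>base\<close>;
  this is the quantitative continuity of the coding.\<close>

lemma dist_coded_agree_le:
  assumes "\<And>i. s i \<le> i + c" "\<And>i. s' i \<le> i + c" "\<And>i. i < m \<Longrightarrow> s i = s' i"
  shows "dist (coded s) (coded s') \<le> 2 * spread * (real c + real m + 2) / 2 ^ m"
proof -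
  have le: "s (m + i) \<le> i + (c + m)" "s' (m + i) \<le> i + (c + m)" for i
    using assms(1,2)[of "m + i"] by simp_all
  let ?t = "coded (\<lambda>i. s (m + i))" and ?t' = "coded (\<lambda>i. s' (m + i))"
  have eq: "coded s = pullback m s ?t" "coded s' = pullback m s ?t'"
    using coded_eq_pullback[OF assms(1), of m] coded_eq_pullback[OF assms(2), of m]
      pullback_cong[of m s s', OF assms(3)] by simp_all
  have "dist (coded s) (coded s') \<le> dist ?t ?t' / 2 ^ m"
    unfolding eq by (intro dist_pullback_le coded_in_hplane[OF le(1)] coded_in_hplane[OF le(2)])
  also have "dist ?t ?t' \<le> dist ?t base + dist ?t' base"
    by (rule dist_triangle2)
  also have "\<dots> \<le> 2 * spread * (real c + real m + 2)"
    using dist_coded_base_le[OF le(1)] dist_coded_base_le[OF le(2)] by (simp add: algebra_simps)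
  finally show ?thesis
    by (simp add: divide_right_mono)
qed

lemma coded_escapes:
  assumes "\<And>i. s i \<le> i" "filterlim s at_top sequentially"
  shows "coded s \<in> escaping_set (exp_map a)"
proof -
  have "real (s n) \<le> cmod ((exp_map a ^^ n) (coded s))" for n
  proof -
    have "s (n + i) \<le> i + n" for i
      using assms(1)[of "n + i"] by simp
    then have "real (s n) \<le> Im (coded (\<lambda>i. s (n + i)))"
      using Im_coded_ge[of "\<lambda>i. s (n + i)" n] by simp
    also have "\<dots> \<le> cmod (coded (\<lambda>i. s (n + i)))"
      using abs_Im_le_cmod by (meson abs_le_D1)
    finally show ?thesis
      using exp_map_funpow_coded[of s 0 n] assms(1) by simp
  qed
  then show ?thesis
    unfolding escaping_set_def mem_Collect_eq
    by (intro filterlim_at_top_mono[OF filterlim_compose[OF filterlim_real_sequentially assms(2)]])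
       auto
qed

text \<open>At time \<open>j\<close> the itinerary shares \<open>j\<close> digits with the constant
  one. The block must be as long as its position, since the a priori bound on the shifted itinerary
  grows with \<open>j\<close> and has to be beaten by \<open>2 ^ j\<close>.\<close>

lemma coded_not_escaping:
  assumes le: "\<And>i. s i \<le> i"
    and blocks: "\<And>N. \<exists>j\<ge>N. \<forall>i<j. s (j + i) = n"
  shows "coded s \<notin> escaping_set (exp_map a)"
proof
  assume "coded s \<in> escaping_set (exp_map a)"
  then have lim: "filterlim (\<lambda>j. cmod ((exp_map a ^^ j) (coded s))) at_top sequentially"
    by (simp add: escaping_set_def)
  \<comment> \<open>With common bound \<open>n + j\<close> and \<open>j\<close> equal digits, the
    estimate involves \<open>(n + 2 * j + 2) / 2 ^ j\<close>, which is at most \<open>n + 4\<close>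
    because \<open>j < 2 ^ j\<close>.\<close>
  define C where "C = cmod (coded (\<lambda>_. n)) + 2 * spread * (real n + 4)"
  from lim obtain N where N: "\<And>j. j \<ge> N \<Longrightarrow> C < cmod ((exp_map a ^^ j) (coded s))"
    by (auto simp: filterlim_at_top_dense eventually_sequentially)
  obtain j where j: "j \<ge> N" "\<And>i. i < j \<Longrightarrow> s (j + i) = n"
    using blocks by blast
  have le1: "s (j + i) \<le> i + (n + j)" for i
    using le[of "j + i"] by simp
  have le2: "n \<le> i + (n + j)" for i
    by simp
  have "real n + 2 \<le> (real n + 2) * 2 ^ j"
    using mult_left_mono[of 1 "2 ^ j" "real n + 2"] by simp
  then have "real (n + j) + real j + 2 \<le> (real n + 4) * 2 ^ j"
    using of_nat_less_two_power[of j, where 'a = real]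
    unfolding distrib_right of_nat_add by linarith
  then have "(real (n + j) + real j + 2) / 2 ^ j \<le> real n + 4"
    by (simp add: divide_le_eq)
  then have "2 * spread * ((real (n + j) + real j + 2) / 2 ^ j) \<le> 2 * spread * (real n + 4)"
    using spread_nonneg by (intro mult_left_mono) auto
  then have "dist (coded (\<lambda>i. s (j + i))) (coded (\<lambda>_. n)) \<le> 2 * spread * (real n + 4)"
    using dist_coded_agree_le[OF le1 le2 j(2), of j] by simp
  then have "cmod (coded (\<lambda>i. s (j + i))) \<le> C"
    using norm_triangle_ineq2[of "coded (\<lambda>i. s (j + i))" "coded (\<lambda>_. n)"]
    by (simp add: C_def dist_norm)
  moreover have "(exp_map a ^^ j) (coded s) = coded (\<lambda>i. s (j + i))"
    using exp_map_funpow_coded[of s 0 j] le by simp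
  ultimately show False
    using N[OF j(1)] by simp
qed

text \<open>Continuity of the coding at \<open>s\<close>; the free \<open>N\<close> allows prefixes
  to be lengthened at will.\<close>

lemma cylinder_in_open:
  assumes "open U" "coded s \<in> U" "\<And>i. s i \<le> i"
  shows "\<exists>m>N. \<forall>s'. (\<forall>i. s' i \<le> i) \<longrightarrow> (\<forall>i<m. s' i = s i) \<longrightarrow> coded s' \<in> U"
proof -
  obtain e where e: "e > 0" "\<And>y. dist y (coded s) < e \<Longrightarrow> y \<in> U"
    using assms(1,2) unfolding open_dist by blast
  have "\<forall>\<^sub>F m in sequentially. 2 * spread * (real 0 + real m + 2) / 2 ^ m < e \<and> m > N"
    by (intro eventually_conj order_tendstoD(2)[OF linear_over_power2_tendsto_0 e(1)] eventually_gt_at_top)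
  then obtain m where m: "2 * spread * (real 0 + real m + 2) / 2 ^ m < e" "m > N"
    using eventually_happens'[OF sequentially_bot] by blast
  show ?thesis
  proof (intro exI[of _ m] conjI allI impI m(2))
    fix s' assume "\<forall>i. s' i \<le> i" "\<forall>i<m. s' i = s i"
    then have "dist (coded s') (coded s) \<le> 2 * spread * (real 0 + real m + 2) / 2 ^ m"
      using assms(3) by (intro dist_coded_agree_le) auto
    with m(1) e(2) show "coded s' \<in> U"
      by simp
  qed
qed

end

section \<open>The category argument on spaces of itineraries\<close>

lemma diagonal_sequence:
  fixes t :: "nat \<Rightarrow> nat \<Rightarrow> 'a" and m :: "nat \<Rightarrow> nat"
  assumes mono: "strict_mono m" and agree: "\<And>j i. i < m j \<Longrightarrow> t (Suc j) i = t j i"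
  obtains s where "\<And>j i. i < m j \<Longrightarrow> s i = t j i"
proof
  have later: "t k i = t j i" if "j \<le> k" "i < m j" for i j k
    using that(1)
  proof (induction k rule: dec_induct)
    case (step k)
    have "i < m k"
      using that(2) step.hyps(1) strict_mono_mono[OF mono] by (meson less_le_trans monoD)
    then show ?case
      using agree step.IH by simp
  qed simp
  fix i j assume "i < m j"
  \<comment> \<open>Digit \<open>i\<close> is settled by stage \<open>Suc i\<close>, so the limit is
    read off on the diagonal.\<close>
  moreover have "i < m (Suc i)"
    using strict_mono_imp_increasing[OF mono, of "Suc i"] by simp
  ultimately show "t (Suc i) i = t j i"
    using later by (metis nle_le)
qed

text \<open>The lower bound \<open>n\<close> on the free digits will make the final itinerary tend
  to infinity, while still permitting blocks of the digit \<open>n\<close> itself.\<close>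

definition extends :: "nat \<Rightarrow> nat \<Rightarrow> (nat \<Rightarrow> nat) \<Rightarrow> (nat \<Rightarrow> nat) \<Rightarrow> bool" where
  "extends n m t s \<longleftrightarrow> (\<forall>i. s i \<le> i) \<and> (\<forall>i<m. s i = t i) \<and> (\<forall>i\<ge>m. s i \<ge> n)"

lemma cylinder_avoiding_gdelta:
  assumes "gdelta X" "X \<subseteq> escaping_set (exp_map a)"
    and t: "\<And>i. t i \<le> i" and "n \<le> m"
  shows "\<exists>t' m'. extends n m t t' \<and> m' > m \<and> (\<forall>s. extends n m' t' s \<longrightarrow> coded a s \<notin> X)"
proof (rule ccontr)
  assume "\<not> ?thesis"
  then have dense: "\<exists>s. extends n m' t' s \<and> coded a s \<in> X" if "extends n m t t'" "m' > m" for t' m'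
    using that by blast
  obtain U :: "nat \<Rightarrow> complex set" where U: "\<And>j. open (U j)" "X = (\<Inter>j. U j)"
    using assms(1) by (auto elim: gdelta.cases)
  define P where "P = (\<lambda>(j::nat) (t', m'). extends n m t t' \<and> m' > m)"
  \<comment> \<open>Stage \<open>j\<close> keeps the old prefix, inserts a block of \<open>n\<close>
    as long as its starting position, and forces the whole new cylinder into
    \<open>U j\<close>.\<close>
  define Q where "Q = (\<lambda>j (t', m') (t'', m''). m' < m'' \<and> (\<forall>i<m'. t'' i = t' i) \<and>
      (\<exists>k>m'. \<forall>i<k. k + i < m'' \<and> t'' (k + i) = n) \<and>
      (\<forall>s. (\<forall>i. s i \<le> i) \<longrightarrow> (\<forall>i<m''. s i = t'' i) \<longrightarrow> coded a s \<in> U j))"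
  have "\<exists>x. P 0 x"
  proof
    \<comment> \<open>Filling with \<open>n\<close> respects \<open>s i \<le> i\<close> because
      \<open>n \<le> m\<close>.\<close>
    show "P 0 (\<lambda>i. if i < m then t i else n, Suc m)"
      using t \<open>n \<le> m\<close> by (auto simp: P_def extends_def)
  qed
  moreover have "\<exists>y. P (Suc j) y \<and> Q j x y" if Px: "P j x" for x j
  proof -
    obtain t' m' where x: "x = (t', m')"
      by fastforce
    then have t': "extends n m t t'" "m' > m"
      using Px by (auto simp: P_def)
    then obtain s where s: "extends n m' t' s" "coded a s \<in> X"
      using dense by blast
    then have "coded a s \<in> U j" "\<And>i. s i \<le> i"
      using U(2) by (auto simp: extends_def)
    then obtain k where k: "k > m'"
      "\<And>s'. (\<forall>i. s' i \<le> i) \<Longrightarrow> (\<forall>i<k. s' i = s i) \<Longrightarrow> coded a s' \<in> U j"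
      using cylinder_in_open[OF U(1)] by metis
    \<comment> \<open>The first \<open>k\<close> digits of \<open>s\<close> already secure
      \<open>U j\<close>; prefix length \<open>2 * k\<close> then fixes a block of \<open>n\<close>
      on positions \<open>k\<close> to \<open>2 * k - 1\<close>.\<close>
    define t'' where "t'' = (\<lambda>i. if i < k then s i else n)"
    have "extends n m t t''"
      unfolding extends_def
    proof (intro conjI allI impI)
      show "t'' i \<le> i" for i
        using s(1) t'(2) k(1) \<open>n \<le> m\<close> by (simp add: extends_def t''_def)
      show "t'' i = t i" if "i < m" for i
        using s(1) t' k(1) that by (simp add: extends_def t''_def)
      show "t'' i \<ge> n" if "i \<ge> m" for i
        using s(1) t' that by (cases "i < m'") (simp_all add: extends_def t''_def)
    qed
    then have "P (Suc j) (t'', 2 * k)"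
      using t'(2) k(1) by (simp add: P_def)
    moreover have "Q j (t', m') (t'', 2 * k)"
      unfolding Q_def prod.case
    proof (intro conjI)
      show "m' < 2 * k" using k(1) by simp
      show "\<forall>i<m'. t'' i = t' i"
        using s(1) k(1) by (auto simp: extends_def t''_def)
      show "\<exists>k'>m'. \<forall>i<k'. k' + i < 2 * k \<and> t'' (k' + i) = n"
        using k(1) by (intro exI[of _ k]) (auto simp: t''_def)
      show "\<forall>s'. (\<forall>i. s' i \<le> i) \<longrightarrow> (\<forall>i<2 * k. s' i = t'' i) \<longrightarrow> coded a s' \<in> U j"
        using k(2) by (auto simp: t''_def)
    qed
    ultimately show ?thesis
      using x by blast
  qed
  ultimately obtain f where f: "\<And>j. P j (f j)" "\<And>j. Q j (f j) (f (Suc j))"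
    using dependent_nat_choice[of P Q] by blast
  define T where "T = (\<lambda>j. fst (f j))"
  define M where "M = (\<lambda>j. snd (f j))"
  have f_eq: "f j = (T j, M j)" for j
    by (simp add: T_def M_def)
  have T: "extends n m t (T j)" for j
    using f(1)[of j] by (simp add: f_eq P_def)
  have Q: "Q j (T j, M j) (T (Suc j), M (Suc j))" for j
    using f(2)[of j] by (simp add: f_eq)
  have M: "strict_mono M"
    using Q by (simp add: Q_def strict_mono_Suc_iff)
  moreover have "T (Suc j) i = T j i" if "i < M j" for i j
    using Q[of j] that by (simp add: Q_def)
  ultimately obtain s where s: "\<And>j i. i < M j \<Longrightarrow> s i = T j i"
    using diagonal_sequence by metis
  have le: "s i \<le> i" for i
    using s[of i "Suc i"] T[of "Suc i"] strict_mono_imp_increasing[OF M, of "Suc i"]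
    by (simp add: extends_def)
  have "coded a s \<in> U j" for j
    using Q[of j] s[of _ "Suc j"] le by (simp add: Q_def)
  then have "coded a s \<in> escaping_set (exp_map a)"
    using U(2) assms(2) by blast
  moreover have "\<exists>k\<ge>N. \<forall>i<k. s (k + i) = n" for N
  proof -
    obtain k where "k > M N" "\<forall>i<k. k + i < M (Suc N) \<and> T (Suc N) (k + i) = n"
      using Q[of N] by (auto simp: Q_def)
    then show ?thesis
      using s[of _ "Suc N"] strict_mono_imp_increasing[OF M, of N] by (intro exI[of _ k]) auto
  qed
  ultimately show False
    using coded_not_escaping[OF le] by blast
qed

section \<open>Preimages of \<open>X\<close> and the final itinerary\<close>

lemma escaping_set_funpow:
  assumes "(f ^^ n) z \<in> escaping_set f"
  shows "z \<in> escaping_set f"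
proof -
  have "\<forall>\<^sub>F k in sequentially. Z \<le> norm ((f ^^ (k + n)) z)" for Z
    using assms by (simp add: escaping_set_def filterlim_at_top funpow_add)
  then have "\<forall>\<^sub>F k in sequentially. Z \<le> norm ((f ^^ k) z)" for Z
    using eventually_sequentially_seg[of "\<lambda>k. Z \<le> norm ((f ^^ k) z)" n] by blast
  then show ?thesis
    by (simp add: escaping_set_def filterlim_at_top)
qed

lemma gdelta_vimage_funpow:
  assumes "gdelta X"
  shows "gdelta ((exp_map a ^^ n) -` X)"
proof -
  obtain U :: "nat \<Rightarrow> complex set" where U: "\<And>j. open (U j)" "X = (\<Inter>j. U j)"
    using assms by (auto elim: gdelta.cases)
  have "continuous_on UNIV (exp_map a ^^ n)"
  proof (induction n)
    case (Suc n)
    then have "continuous_on UNIV (\<lambda>z. exp ((exp_map a ^^ n) z) + a)"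
      by (intro continuous_intros)
    then show ?case
      by (simp add: o_def exp_map_def[abs_def])
  qed (simp add: id_def)
  then have "open ((exp_map a ^^ n) -` U j)" for j
    using U(1) by (rule open_vimage[rotated])
  moreover have "(exp_map a ^^ n) -` X = (\<Inter>j. (exp_map a ^^ n) -` U j)"
    using U(2) by auto
  ultimately show ?thesis
    using gdelta.intros by metis
qed

theorem corollary2:
  fixes a :: complex and X :: "complex set"
  assumes "gdelta X"
    and "X \<subseteq> escaping_set (exp_map a)"
  shows "\<not> escaping_set (exp_map a) \<subseteq> (\<Union>n::nat. (exp_map a ^^ n) -` X) \<and>
    (\<exists>z\<in>escaping_set (exp_map a). \<forall>n::nat. (exp_map a ^^ n) z \<notin> X)"
proof -
  define P where "P = (\<lambda>(j::nat) (t::nat \<Rightarrow> nat, m). (\<forall>i. t i \<le> i) \<and> j \<le> m)"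
  \<comment> \<open>Stage \<open>j\<close> avoids the \<open>j\<close>-th preimage using new digits
    at least \<open>j\<close>; the invariant \<open>j \<le> m\<close> in \<open>P\<close> is what
    the cylinder lemma requires.\<close>
  define Q where "Q = (\<lambda>j (t, m) (t', m'). extends j m t t' \<and> m < m' \<and>
      (\<forall>s. extends j m' t' s \<longrightarrow> (exp_map a ^^ j) (coded a s) \<notin> X))"
  have "\<exists>x. P 0 x"
    by (rule exI[of _ "(\<lambda>_. 0, 0)"]) (simp add: P_def)
  moreover have "\<exists>y. P (Suc j) y \<and> Q j x y" if Px: "P j x" for x j
  proof -
    obtain t m where x: "x = (t, m)"
      by fastforce
    have "(exp_map a ^^ j) -` X \<subseteq> escaping_set (exp_map a)"
      using assms(2) escaping_set_funpow by blast
    moreover have "\<And>i. t i \<le> i" "j \<le> m"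
      using Px by (auto simp: x P_def)
    ultimately obtain t' m' where "extends j m t t'" "m' > m"
      "\<forall>s. extends j m' t' s \<longrightarrow> coded a s \<notin> (exp_map a ^^ j) -` X"
      using cylinder_avoiding_gdelta[OF gdelta_vimage_funpow[OF assms(1)]] by metis
    then show ?thesis
      using \<open>j \<le> m\<close> by (intro exI[of _ "(t', m')"]) (auto simp: x P_def Q_def extends_def)
  qed
  ultimately obtain f where f: "\<And>j. P j (f j)" "\<And>j. Q j (f j) (f (Suc j))"
    using dependent_nat_choice[of P Q] by blast
  define T where "T = (\<lambda>j. fst (f j))"
  define M where "M = (\<lambda>j. snd (f j))"
  have f_eq: "f j = (T j, M j)" for j
    by (simp add: T_def M_def)
  have T: "T j i \<le> i" for i j
    using f(1)[of j] by (simp add: f_eq P_def)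
  have Q: "extends j (M j) (T j) (T (Suc j))" "M j < M (Suc j)"
      "extends j (M (Suc j)) (T (Suc j)) s \<Longrightarrow> (exp_map a ^^ j) (coded a s) \<notin> X" for j s
    using f(2)[of j] by (simp_all add: f_eq Q_def)
  have M: "strict_mono M"
    using Q(2) by (simp add: strict_mono_Suc_iff)
  moreover have "T (Suc j) i = T j i" if "i < M j" for i j
    using Q(1)[of j] that by (simp add: extends_def)
  ultimately obtain s where s: "\<And>j i. i < M j \<Longrightarrow> s i = T j i"
    using diagonal_sequence by metis
  have i_less: "i < M (Suc i)" for i
    using strict_mono_imp_increasing[OF M, of "Suc i"] by simp
  have le: "s i \<le> i" for i
    using s[OF i_less] T by simp
  \<comment> \<open>Stage \<open>n\<close> makes all digits from \<open>M n\<close> on at least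
    \<open>n\<close>; each later stage \<open>k\<close> either keeps a digit or replaces it by one
    at least \<open>k\<close>.\<close>
  have T_ge: "T k i \<ge> n" if "Suc n \<le> k" "i \<ge> M n" for i k n
    using that(1)
  proof (induction k rule: dec_induct)
    case base
    show ?case
      using Q(1)[of n] that(2) by (simp add: extends_def)
  next
    case (step k)
    moreover have "n \<le> T (Suc k) i" if "i \<ge> M k"
      using Q(1)[of k] that step.hyps(1) by (meson extends_def Suc_leD le_trans)
    ultimately show ?case
      using Q(1)[of k] by (cases "i < M k") (simp_all add: extends_def)
  qed
  have s_ge: "s i \<ge> n" if i: "i \<ge> M n" for i n
  proof -
    have "i < M (Suc (max n i))"
      using i_less[of i] monoD[OF strict_mono_mono[OF M], of "Suc i" "Suc (max n i)"] by simp
    then show ?thesis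
      using s T_ge[of n "Suc (max n i)" i] i by simp
  qed
  have "filterlim s at_top sequentially"
    unfolding filterlim_at_top eventually_sequentially using s_ge by blast
  then have "coded a s \<in> escaping_set (exp_map a)"
    using coded_escapes[OF le] by blast
  moreover have "(exp_map a ^^ n) (coded a s) \<notin> X" for n
  proof (rule Q(3))
    \<comment> \<open>The limit itinerary lies in the cylinder chosen at stage \<open>n\<close>: its
      later digits may be larger than \<open>n\<close>, but never smaller.\<close>
    show "extends n (M (Suc n)) (T (Suc n)) s"
      using le s s_ge Q(2)[of n] by (auto simp: extends_def)
  qed
  ultimately show ?thesis
    by blast
qed

end
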